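(* Let $X=(X_1,\dots,X_p)$ be a random vector, let $Y=f(X)$ be square-integrable with $\mathrm{Var}(Y)\neq 0$, and let $\mathcal{C}=\{C_1,\dots,C_k\}$ be a partition of $[1:p]$ such that the groups of random variables $A_1=X_{C_1},\dots,A_k=X_{C_k}$ are independent. Suppose the model is block-additive, i.e. $Y=\sum_{j=1}^kg_j(A_j)$ for some functions $g_1,\dots,g_k$. Then for all $u\subseteq[1:p]$ such that $u\nsubseteq C_j$ for all $j\in[1:k]$, the Sobol index $S_u$ of $Y$ satisfies $S_u=0$.
   Context: Let $(\Omega,\mathcal{A},\mathbb{P})$ be a probability space, let $E=\times_{i=1}^pE_i$ be a product of measurable spaces $(E_i,\mathcal{E}_i)$ with the product $\sigma$-algebra $\mathcal{E}=\otimes_{i=1}^p\mathcal{E}_i$, and let $X=(X_1,\dots,X_p):\Omega\to E$ be a random variable. Let $f:(E,\mathcal{E})\to(\mathbb{R},\mathcal{B}(\mathbb{R}))$ be measurable with $f(X)\in L^2$; $Y:=f(X)$, and $\mathrm{Var}(Y)\neq0$ is assumed. $[1:p]$ is the set of integers from $1$ to $p$, and $|u|$ is the cardinality of $u$. For $u\subseteq[1:p]$, $x_u:=(x_i)_{i\in u}$; conditioning on $X_\emptyset$ is trivial conditioning, i.e. $\mathrm{E}(\cdot\mid X_\emptyset)=\mathrm{E}(\cdot)$. Put $V_u:=\mathrm{Var}(\mathrm{E}(Y\mid X_u))$. The Sobol indices of $Y$ are $$S_u:=\frac{1}{\mathrm{Var}(Y)}\sum_{v\subseteq u}(-1)^{|u|-|v|}V_v,\qquad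 u\subseteq[1:p].$$ The (nonempty, disjoint) sets $C_1,\dots,C_k$ partition $[1:p]$, and $A_j:=X_{C_j}$. The functions $g_j$ are real-valued, measurable, with $g_j(A_j)\in L^2$. *)

theory Defs
  imports "HOL-Probability.Probability"
begin

text \<open>
  A random vector is a map \<open>X :: 'w \<Rightarrow> nat \<Rightarrow> 'a\<close> into a product \<open>\<Pi>\<^sub>M i\<in>{1..p}. N i\<close>. The factors
  \<open>N i\<close> share the carrier type \<open>'a\<close>, but their spaces and \<open>\<sigma>\<close>-algebras may all differ.
\<close>

definition subvector :: "('w \<Rightarrow> nat \<Rightarrow> 'a) \<Rightarrow> nat set \<Rightarrow> 'w \<Rightarrow> nat \<Rightarrow> 'a" where
  "subvector X u = (\<lambda>\<omega>. restrict (X \<omega>) u)"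

text \<open>
  Conditioning on \<open>X\<^sub>u\<close> is conditioning on the \<open>\<sigma>\<close>-algebra generated by \<open>X\<^sub>u\<close>. For \<open>u = {}\<close> this
  \<open>\<sigma>\<close>-algebra is trivial, so that the conditional expectation is a.s. the plain expectation.
\<close>

definition cond_exp_subvector ::
    "'w measure \<Rightarrow> (nat \<Rightarrow> 'a measure) \<Rightarrow> ('w \<Rightarrow> nat \<Rightarrow> 'a) \<Rightarrow> ('w \<Rightarrow> real) \<Rightarrow> nat set \<Rightarrow> 'w \<Rightarrow> real" where
  "cond_exp_subvector M N X Y u =
     real_cond_exp M (vimage_algebra (space M) (subvector X u) (PiM u N)) Y"

definition closed_sobol_var ::
    "'w measure \<Rightarrow> (nat \<Rightarrow> 'a measure) \<Rightarrow> ('w \<Rightarrow> nat \<Rightarrow> 'a) \<Rightarrow> ('w \<Rightarrow> real) \<Rightarrow> nat set \<Rightarrow> real" where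
  "closed_sobol_var M N X Y u = prob_space.variance M (cond_exp_subvector M N X Y u)"

definition sobol_index ::
    "'w measure \<Rightarrow> (nat \<Rightarrow> 'a measure) \<Rightarrow> ('w \<Rightarrow> nat \<Rightarrow> 'a) \<Rightarrow> ('w \<Rightarrow> real) \<Rightarrow> nat set \<Rightarrow> real" where
  "sobol_index M N X Y u =
     1 / prob_space.variance M Y *
     (\<Sum>v\<in>Pow u. (- 1) ^ (card u - card v) * closed_sobol_var M N X Y v)"

end

theory Submission
  imports Defs
begin

text \<open>
  Write \<open>\<sigma>(X\<^sub>u)\<close> for the \<open>\<sigma>\<close>-algebra generated by \<open>X\<^sub>u\<close>. The point is that, for a block-additive model
  with independent blocks, \<open>V\<^sub>v\<close> splits into terms that each see a single block:
  \<open>V\<^sub>v = (\<Sum>j. c\<^sub>j (v \<inter> C\<^sub>j))\<close> with \<open>c\<^sub>j w = Var (E (g\<^sub>j (A\<^sub>j) | X\<^sub>w))\<close>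
  (\<open>closed_sobol_var_block_additive\<close>). A term that only depends on \<open>v \<inter> C\<^sub>j\<close> does not change when a
  coordinate outside \<open>C\<^sub>j\<close> is added to \<open>v\<close>. If \<open>u\<close> is not contained in \<open>C\<^sub>j\<close> there is such a coordinate
  in \<open>u\<close>, and pairing the subsets of \<open>u\<close> with and without it cancels the contribution of \<open>c\<^sub>j\<close> to the
  alternating sum \<open>S\<^sub>u\<close> (\<open>alternating_sum_Pow_eq_0\<close>). When no block contains \<open>u\<close>, every contribution
  cancels.

  The splitting has two ingredients. First, \<open>X\<^bsub>v - C\<^sub>j\<^esub>\<close> is independent of \<open>A\<^sub>j\<close>, so that conditioning
  \<open>g\<^sub>j (A\<^sub>j)\<close> on \<open>X\<^sub>v\<close> is the same as conditioning it on \<open>X\<^bsub>v \<inter> C\<^sub>j\<^esub>\<close> alone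
  (\<open>real_cond_exp_join_indep\<close>). Second, the functions \<open>E (g\<^sub>j (A\<^sub>j) | X\<^bsub>v \<inter> C\<^sub>j\<^esub>)\<close> are measurable with respect
  to the independent \<open>\<sigma>\<close>-algebras \<open>\<sigma>(A\<^sub>j)\<close>, so the variance of their sum is the sum of their
  variances (\<open>variance_sum_indep\<close>).
\<close>

section \<open>Alternating sums over a power set\<close>

text \<open>The subsets \<open>v\<close> and \<open>insert i v\<close> of \<open>u\<close> enter with opposite signs and equal values.\<close>

lemma alternating_sum_Pow_eq_0:
  fixes \<phi> :: "'i set \<Rightarrow> 'r :: comm_ring_1"
  assumes "finite u" and "i \<in> u"
    and inv: "\<And>v. v \<subseteq> u - {i} \<Longrightarrow> \<phi> (insert i v) = \<phi> v"
  shows "(\<Sum>v\<in>Pow u. (- 1) ^ (card u - card v) * \<phi> v) = 0"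
proof -
  define w where "w = u - {i}"
  have w: "finite w" "i \<notin> w" "u = insert i w"
    using assms by (auto simp: w_def)
  have "(\<Sum>v\<in>Pow u. (- 1) ^ (card u - card v) * \<phi> v) =
      (\<Sum>v\<in>Pow w. (- 1) ^ (card u - card v) * \<phi> v) +
      (\<Sum>v\<in>insert i ` Pow w. (- 1) ^ (card u - card v) * \<phi> v)"
    unfolding w(3) Pow_insert using w by (intro sum.union_disjoint) auto
  also have "(\<Sum>v\<in>insert i ` Pow w. (- 1) ^ (card u - card v) * \<phi> v) =
      (\<Sum>v\<in>Pow w. (- 1) ^ (card u - card (insert i v)) * \<phi> (insert i v))"
    using w by (subst sum.reindex) (auto simp: inj_on_def)
  also have "\<dots> = (\<Sum>v\<in>Pow w. - ((- 1) ^ (card u - card v) * \<phi> v))"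
  proof (intro sum.cong refl)
    fix v assume "v \<in> Pow w"
    then have v: "v \<subseteq> w" "finite v" "i \<notin> v"
      using w finite_subset by auto
    then have "card u - card v = Suc (card u - card (insert i v))"
      using w card_mono[of w v] by simp
    then show "(- 1) ^ (card u - card (insert i v)) * \<phi> (insert i v) =
        - ((- 1) ^ (card u - card v) * \<phi> v)"
      using inv[of v] v by (simp add: w_def)
  qed
  finally show ?thesis
    by (simp add: sum_negf)
qed

section \<open>Independent sub-\<open>\<sigma>\<close>-algebras\<close>

lemma (in prob_space) sigma_finite_subalgebraI:
  assumes "subalgebra M F"
  shows "sigma_finite_subalgebra M F"
proof -
  interpret finite_measure_subalgebra M F
    by unfold_locales fact
  show ?thesis
    by (rule sigma_finite_subalgebra_axioms)
qed

lemma (in prob_space) indep_var_from_indep_subalgebras: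
  assumes AB: "subalgebra M A" "subalgebra M B" and indep: "indep_set (sets A) (sets B)"
    and f: "f \<in> measurable A S" and g: "g \<in> measurable B T"
  shows "indep_var S f T g"
proof -
  have sp: "space A = space M" "space B = space M"
    using AB by (auto simp: subalgebra_def)
  have "sigma_sets (space M) {f -` E \<inter> space M |E. E \<in> sets S} \<subseteq> sets A"
    using measurable_sets[OF f] sp(1)[symmetric] by (auto intro!: sets.sigma_sets_subset)
  moreover have "sigma_sets (space M) {g -` E \<inter> space M |E. E \<in> sets T} \<subseteq> sets B"
    using measurable_sets[OF g] sp(2)[symmetric] by (auto intro!: sets.sigma_sets_subset)
  ultimately have "indep_set (sigma_sets (space M) {f -` E \<inter> space M |E. E \<in> sets S})
      (sigma_sets (space M) {g -` E \<inter> space M |E. E \<in> sets T})"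
    using indep unfolding indep_sets2_eq by blast
  then show ?thesis
    unfolding indep_var_eq
    using measurable_from_subalg[OF AB(1) f] measurable_from_subalg[OF AB(2) g] by blast
qed

text \<open>
  Both sides integrate to \<open>E (Z; a) \<cdot> P b\<close> over \<open>a \<inter> b\<close> with \<open>a \<in> \<G>\<close>, \<open>b \<in> \<H>\<close>, because \<open>Z\<close> and
  \<open>E (Z | \<G>)\<close> are both \<open>\<A>\<close>-measurable and \<open>\<A>\<close> is independent of \<open>\<H>\<close>. These intersections form a
  \<open>\<pi>\<close>-system that generates \<open>\<K> = \<G> \<or> \<H>\<close>, and a Dynkin class argument extends the equality to \<open>\<K>\<close>.
\<close>

lemma (in prob_space) real_cond_exp_join_indep:
  assumes A: "subalgebra M A" and G: "subalgebra A G" and H: "subalgebra M H"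
    and K: "subalgebra M K" "sets K = sigma_sets (space M) {a \<inter> b |a b. a \<in> sets G \<and> b \<in> sets H}"
    and indep: "indep_set (sets A) (sets H)"
    and Z: "Z \<in> borel_measurable A" "integrable M Z"
  shows "AE x in M. real_cond_exp M K Z x = real_cond_exp M G Z x"
proof -
  have MG: "subalgebra M G"
    using A G by (auto simp: subalgebra_def)
  interpret K: sigma_finite_subalgebra M K
    by (rule sigma_finite_subalgebraI) fact
  interpret G: sigma_finite_subalgebra M G
    by (rule sigma_finite_subalgebraI) fact
  define W where "W = real_cond_exp M G Z"
  have W: "integrable M W" "W \<in> borel_measurable G"
    using G.real_cond_exp_int(1)[OF Z(2)] by (auto simp: W_def)
  have WA: "W \<in> borel_measurable A"
    by (rule measurable_from_subalg[OF G W(2)])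
  have sp: "space A = space M" "space G = space M" "space H = space M"
    using A MG H by (auto simp: subalgebra_def)
  have sub: "sets G \<subseteq> sets A" "sets H \<subseteq> sets M" "sets G \<subseteq> sets M" "sets K \<subseteq> sets M"
    using G H MG K by (auto simp: subalgebra_def)
  have GK: "sets G \<subseteq> sets K"
  proof
    fix a assume a: "a \<in> sets G"
    then have "a = a \<inter> space M"
      using sets.sets_into_space sp by blast
    then show "a \<in> sets K"
      unfolding K(2) using a sets.top[of H] sp by blast
  qed
  have WK: "W \<in> borel_measurable K"
    using W(2) GK K(1) sp by (auto simp: measurable_def subalgebra_def)
  have prod: "(LINT x:a \<inter> b|M. U x) = (LINT x:a|M. U x) * prob b"
    if U: "U \<in> borel_measurable A" "integrable M U" and a: "a \<in> sets G" and b: "b \<in> sets H" for U a b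
  proof -
    have aU: "(\<lambda>x. indicator a x * U x) \<in> borel_measurable A"
      using a sub(1) U(1) by (intro borel_measurable_times borel_measurable_indicator) auto
    have "indep_var borel (\<lambda>x. indicator a x * U x) borel (indicator b :: 'a \<Rightarrow> real)"
      using b by (intro indep_var_from_indep_subalgebras[OF A H indep aU]) auto
    moreover have "integrable M (\<lambda>x. indicator a x * U x)"
      using integrable_mult_indicator[of a M U] U(2) a sub(3) by auto
    moreover have "integrable M (indicator b :: 'a \<Rightarrow> real)"
      using b sub(2) by (auto simp: integrable_indicator_iff emeasure_eq_measure)
    ultimately have "(LINT x|M. indicator a x * U x * indicator b x) =
        (LINT x|M. indicator a x * U x) * (LINT x|M. indicator b x)"
      by (rule indep_var_lebesgue_integral)
    moreover have "(LINT x|M. indicator b x) = prob b"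
      using b sub(2) by auto
    moreover have "(LINT x:a \<inter> b|M. U x) = (LINT x|M. indicator a x * U x * indicator b x)"
      by (simp add: set_lebesgue_integral_def indicator_inter_arith mult_ac)
    ultimately show ?thesis
      by (simp add: set_lebesgue_integral_def)
  qed
  have setint: "set_integrable M E U" if "E \<in> sets K" "integrable M U" for E and U :: "'a \<Rightarrow> real"
    using that sub(4) integrable_mult_indicator[of E M U] by (auto simp: set_integrable_def)
  define D where "D = {a \<inter> b |a b. a \<in> sets G \<and> b \<in> sets H}"
  have KD: "sets K = sigma_sets (space M) D"
    by (simp add: K(2) D_def)
  have "Int_stable D"
  proof (rule Int_stableI)
    fix s t assume "s \<in> D" "t \<in> D"
    then obtain a b a' b' where "s = a \<inter> b" "t = a' \<inter> b'"
      and m: "a \<in> sets G" "b \<in> sets H" "a' \<in> sets G" "b' \<in> sets H"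
      unfolding D_def by blast
    then have "s \<inter> t = (a \<inter> a') \<inter> (b \<inter> b')"
      by auto
    moreover have "a \<inter> a' \<in> sets G" "b \<inter> b' \<in> sets H"
      using m by auto
    ultimately show "s \<inter> t \<in> D"
      unfolding D_def by blast
  qed
  moreover have "D \<subseteq> Pow (space M)"
    using sets.sets_into_space[of _ G] sp by (auto simp: D_def)
  ultimately have eq: "(LINT x:E|M. Z x) = (LINT x:E|M. W x)" if "E \<in> sigma_sets (space M) D" for E
    using that
  proof (induction rule: sigma_sets_induct_disjoint)
    case (basic E)
    then obtain a b where E: "E = a \<inter> b" "a \<in> sets G" "b \<in> sets H"
      unfolding D_def by blast
    show ?case
      using prod[OF Z E(2,3)] prod[OF WA W(1) E(2,3)] G.real_cond_exp_intA[OF Z(2) E(2)]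
      by (simp add: E(1) W_def)
  next
    case empty
    show ?case by (simp add: set_lebesgue_integral_def)
  next
    case (compl E)
    have EK: "E \<in> sets K" "space M - E \<in> sets K"
      using compl(1) KD K(1) by (auto simp: subalgebra_def intro: sigma_sets.Compl)
    have "(LINT x:space M - E|M. U x) = (LINT x|M. U x) - (LINT x:E|M. U x)"
      if "integrable M U" for U :: "'a \<Rightarrow> real"
    proof -
      have "(LINT x:(space M - E) \<union> E|M. U x) = (LINT x:space M - E|M. U x) + (LINT x:E|M. U x)"
        using setint[OF EK(1) that] setint[OF EK(2) that] by (intro set_integral_Un) auto
      moreover have "(space M - E) \<union> E = space M"
        using EK(1) sub(4) sets.sets_into_space[of E M] by auto
      ultimately show ?thesis
        by (simp add: set_integral_space[OF that])
    qed
    then show ?case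
      using compl(2) Z(2) W(1) G.real_cond_exp_int(2)[OF Z(2)] by (simp add: W_def)
  next
    case (union B)
    have B: "B i \<in> sets K" for i
      using union(2) KD by auto
    have UB: "\<Union> (range B) \<in> sets K"
      using B by auto
    have "(LINT x:\<Union> (range B)|M. U x) = (\<Sum>i. LINT x:B i|M. U x)"
      if "integrable M U" for U :: "'a \<Rightarrow> real"
      using union(1) B sub(4) setint[OF UB that]
      by (intro lebesgue_integral_countable_add) (auto simp: disjoint_family_on_def)
    then show ?case
      using union(3) Z(2) W(1) by simp
  qed
  have "AE x in M. real_cond_exp M K Z x = W x"
    using eq Z(2) W(1) WK by (intro K.real_cond_exp_charact) (auto simp: KD)
  then show ?thesis
    by (simp add: W_def)
qed

section \<open>Square-integrable random variables\<close>

lemma (in prob_space) variance_sum_indep: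
  fixes h :: "'i \<Rightarrow> 'a \<Rightarrow> real"
  assumes "finite J"
    and sq: "\<And>j. j \<in> J \<Longrightarrow> integrable M (h j)" "\<And>j. j \<in> J \<Longrightarrow> integrable M (\<lambda>x. (h j x)\<^sup>2)"
    and indep: "\<And>j l. j \<in> J \<Longrightarrow> l \<in> J \<Longrightarrow> j \<noteq> l \<Longrightarrow> indep_var borel (h j) borel (h l)"
  shows "variance (\<lambda>x. \<Sum>j\<in>J. h j x) = (\<Sum>j\<in>J. variance (h j))"
proof -
  define d where "d j x = h j x - expectation (h j)" for j x
  have d: "integrable M (d j)" "expectation (d j) = 0" "integrable M (\<lambda>x. (d j x)\<^sup>2)" if "j \<in> J" for j
  proof -
    show "integrable M (d j)"
      unfolding d_def using sq[OF that] by auto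
    show "expectation (d j) = 0"
      unfolding d_def using sq[OF that] by (simp add: prob_space)
    show "integrable M (\<lambda>x. (d j x)\<^sup>2)"
      unfolding d_def power2_diff using sq[OF that] by auto
  qed
  have dd: "integrable M (\<lambda>x. d j x * d l x) \<and>
      expectation (\<lambda>x. d j x * d l x) = (if j = l then variance (h j) else 0)"
    if "j \<in> J" "l \<in> J" for j l
  proof (cases "j = l")
    case True
    then show ?thesis
      using d(3)[OF that(1)] by (simp add: power2_eq_square d_def)
  next
    case False
    have "indep_var borel ((\<lambda>t. t - expectation (h j)) \<circ> h j) borel ((\<lambda>t. t - expectation (h l)) \<circ> h l)"
      by (rule indep_var_compose[OF indep[OF that False]]) auto
    then have "indep_var borel (d j) borel (d l)"
      by (simp add: d_def[abs_def] comp_def)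
    then show ?thesis
      using indep_var_integrable[of "d j" "d l"] indep_var_lebesgue_integral[of "d j" "d l"]
        d that False by simp
  qed
  have "expectation (\<lambda>x. \<Sum>j\<in>J. h j x) = (\<Sum>j\<in>J. expectation (h j))"
    using sq by (intro Bochner_Integration.integral_sum) auto
  then have "variance (\<lambda>x. \<Sum>j\<in>J. h j x) = expectation (\<lambda>x. \<Sum>j\<in>J. \<Sum>l\<in>J. d j x * d l x)"
    by (simp add: d_def sum_subtractf[symmetric] power2_eq_square sum_product)
  also have "\<dots> = (\<Sum>j\<in>J. \<Sum>l\<in>J. expectation (\<lambda>x. d j x * d l x))"
    using dd by (subst Bochner_Integration.integral_sum) (auto intro!: sum.cong Bochner_Integration.integral_sum)
  also have "\<dots> = (\<Sum>j\<in>J. variance (h j))"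
    using dd \<open>finite J\<close> by (intro sum.cong refl) (simp add: sum.delta)
  finally show ?thesis .
qed

lemma (in prob_space) variance_cong_AE:
  fixes Y Z :: "'a \<Rightarrow> real"
  assumes "AE x in M. Y x = Z x" "Y \<in> borel_measurable M" "Z \<in> borel_measurable M"
  shows "variance Y = variance Z"
proof -
  have "expectation Y = expectation Z"
    using assms by (intro integral_cong_AE) auto
  then show ?thesis
    using assms by (intro integral_cong_AE) auto
qed

lemma (in prob_space) integrable_real_cond_exp_power2:
  assumes "subalgebra M F" "integrable M Z" "integrable M (\<lambda>x. (Z x)\<^sup>2)"
  shows "integrable M (\<lambda>x. (real_cond_exp M F Z x)\<^sup>2)"
proof -
  interpret sigma_finite_subalgebra M F
    by (rule sigma_finite_subalgebraI) fact
  show ?thesis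
    using assms convex_power2 emeasure_space_1
    by (intro integrable_convex_cond_exp[where q = "\<lambda>t. t\<^sup>2" and I = UNIV]) auto
qed

section \<open>The \<open>\<sigma>\<close>-algebras generated by subvectors\<close>

definition sigma_subvector :: "'w measure \<Rightarrow> (nat \<Rightarrow> 'a measure) \<Rightarrow> ('w \<Rightarrow> nat \<Rightarrow> 'a) \<Rightarrow> nat set \<Rightarrow> 'w measure"
  where "sigma_subvector M N X u = vimage_algebra (space M) (subvector X u) (PiM u N)"

lemma space_sigma_subvector [simp]: "space (sigma_subvector M N X u) = space M"
  by (simp add: sigma_subvector_def)

lemma subvector_measurable:
  assumes "X \<in> measurable M (PiM I N)" "u \<subseteq> I"
  shows "subvector X u \<in> measurable M (PiM u N)"
  unfolding subvector_def
  by (rule measurable_compose[OF assms(1) measurable_restrict_subset[OF assms(2)]])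

lemma subvector_measurable_sigma_subvector:
  assumes "X \<in> measurable M (PiM I N)" "u \<subseteq> I"
  shows "subvector X u \<in> measurable (sigma_subvector M N X u) (PiM u N)"
  unfolding sigma_subvector_def
  using measurable_space[OF subvector_measurable[OF assms]]
  by (intro measurable_vimage_algebra1) auto

lemma component_measurable_sigma_subvector:
  assumes "X \<in> measurable M (PiM I N)" "u \<subseteq> I" "i \<in> u"
  shows "(\<lambda>\<omega>. X \<omega> i) \<in> measurable (sigma_subvector M N X u) (N i)"
proof -
  have "(\<lambda>\<omega>. subvector X u \<omega> i) \<in> measurable (sigma_subvector M N X u) (N i)"
    by (rule measurable_compose[OF subvector_measurable_sigma_subvector[OF assms(1,2)]
          measurable_component_singleton[OF assms(3)]])
  then show ?thesis
    using assms(3) by (simp add: subvector_def)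
qed

lemma sets_sigma_subvector_subset:
  assumes "space F = space M" and "\<And>i. i \<in> u \<Longrightarrow> (\<lambda>\<omega>. X \<omega> i) \<in> measurable F (N i)"
  shows "sets (sigma_subvector M N X u) \<subseteq> sets F"
proof -
  have "subvector X u \<in> measurable F (PiM u N)"
    unfolding subvector_def using assms(2) by (intro measurable_restrict)
  then show ?thesis
    unfolding sigma_subvector_def sets_vimage_algebra assms(1)[symmetric]
    using measurable_sets by (intro sets.sigma_sets_subset) blast
qed

lemma subalgebra_sigma_subvector:
  assumes X: "X \<in> measurable M (PiM I N)" and u: "u \<subseteq> I"
  shows "subalgebra M (sigma_subvector M N X u)"
proof -
  have "(\<lambda>\<omega>. X \<omega> i) \<in> measurable M (N i)" if "i \<in> u" for i
    using that u by (intro measurable_compose[OF X measurable_component_singleton]) blast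
  then have "sets (sigma_subvector M N X u) \<subseteq> sets M"
    by (rule sets_sigma_subvector_subset[OF refl])
  then show ?thesis
    by (simp add: subalgebra_def)
qed

lemma subalgebra_sigma_subvector_mono:
  assumes X: "X \<in> measurable M (PiM I N)" and u: "u \<subseteq> I" and v: "v \<subseteq> u"
  shows "subalgebra (sigma_subvector M N X u) (sigma_subvector M N X v)"
proof -
  have "(\<lambda>\<omega>. X \<omega> i) \<in> measurable (sigma_subvector M N X u) (N i)" if "i \<in> v" for i
    using that v by (intro component_measurable_sigma_subvector[OF X u]) blast
  then have "sets (sigma_subvector M N X v) \<subseteq> sets (sigma_subvector M N X u)"
    by (rule sets_sigma_subvector_subset[OF space_sigma_subvector])
  then show ?thesis
    by (simp add: subalgebra_def)
qed

text \<open>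
  Applied to \<open>v \<inter> C\<^sub>j\<close> and \<open>v - C\<^sub>j\<close>, this presents \<open>\<sigma>(X\<^sub>v)\<close> as the join of an \<open>A\<^sub>j\<close>-measurable part and
  a part independent of \<open>A\<^sub>j\<close>, the form in which \<open>real_cond_exp_join_indep\<close> applies.
\<close>

lemma sets_sigma_subvector_Un:
  assumes X: "X \<in> measurable M (PiM I N)" and "u \<subseteq> I" "v \<subseteq> I"
  shows "sets (sigma_subvector M N X (u \<union> v)) = sigma_sets (space M)
    {a \<inter> b |a b. a \<in> sets (sigma_subvector M N X u) \<and> b \<in> sets (sigma_subvector M N X v)}"
    (is "_ = sigma_sets _ ?D")
proof -
  let ?F = "sigma_subvector M N X"
  define K where "K = sigma (space M) ?D"
  have D: "?D \<subseteq> Pow (space M)"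
    using sets.sets_into_space[of _ "?F u"] by auto
  have K: "space K = space M" "sets K = sigma_sets (space M) ?D"
    using D by (auto simp: K_def)
  have "sets (?F u) \<subseteq> sets K"
  proof
    fix a assume "a \<in> sets (?F u)"
    moreover from this have "a = a \<inter> space M"
      using sets.sets_into_space[of a "?F u"] by auto
    ultimately show "a \<in> sets K"
      unfolding K(2) using sets.top[of "?F v"] by (intro sigma_sets.Basic) auto
  qed
  moreover have "sets (?F v) \<subseteq> sets K"
  proof
    fix b assume "b \<in> sets (?F v)"
    moreover from this have "b = space M \<inter> b"
      using sets.sets_into_space[of b "?F v"] by auto
    ultimately show "b \<in> sets K"
      unfolding K(2) using sets.top[of "?F u"] by (intro sigma_sets.Basic) auto
  qed
  ultimately have "(\<lambda>\<omega>. X \<omega> i) \<in> measurable K (N i)" if "i \<in> u \<union> v" for i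
    using that component_measurable_sigma_subvector[OF X \<open>u \<subseteq> I\<close>, of i]
      component_measurable_sigma_subvector[OF X \<open>v \<subseteq> I\<close>, of i] K(1)
    by (auto simp: measurable_def)
  then have "sets (?F (u \<union> v)) \<subseteq> sets K"
    by (intro sets_sigma_subvector_subset K(1))
  moreover have "sets (?F u) \<subseteq> sets (?F (u \<union> v))" "sets (?F v) \<subseteq> sets (?F (u \<union> v))"
    using subalgebra_sigma_subvector_mono[OF X, of "u \<union> v"] \<open>u \<subseteq> I\<close> \<open>v \<subseteq> I\<close>
    by (auto simp: subalgebra_def)
  then have "sigma_sets (space M) ?D \<subseteq> sets (?F (u \<union> v))"
    using sets.sigma_sets_subset[of ?D "?F (u \<union> v)"] by auto
  ultimately show ?thesis
    using K(2) by auto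
qed

text \<open>
  Each coordinate of \<open>X\<^sub>w\<close> can be read off from one of the blocks \<open>A\<^sub>l\<close> with \<open>l \<noteq> j\<close>, so \<open>X\<^sub>w\<close> is a
  measurable function of the family of these blocks, which is independent of \<open>A\<^sub>j\<close>.
\<close>

lemma (in prob_space) indep_set_sigma_subvector:
  assumes indep: "indep_vars (\<lambda>j. PiM (C j) N) (\<lambda>j. subvector X (C j)) J"
    and "j \<in> J" and w: "w \<subseteq> (\<Union>l\<in>J - {j}. C l)"
  shows "indep_set (sets (sigma_subvector M N X (C j))) (sets (sigma_subvector M N X w))"
proof -
  define b where "b i = (SOME l. l \<in> J - {j} \<and> i \<in> C l)" for i
  have b: "b i \<in> J - {j}" "i \<in> C (b i)" if "i \<in> w" for i
  proof -
    have "\<exists>l. l \<in> J - {j} \<and> i \<in> C l"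
      using w that by auto
    from someI_ex[OF this] show "b i \<in> J - {j}" "i \<in> C (b i)"
      by (auto simp: b_def)
  qed
  let ?A = "\<lambda>L \<omega>. \<lambda>l\<in>L. subvector X (C l) \<omega>"
  let ?P = "\<lambda>L. \<Pi>\<^sub>M l\<in>L. PiM (C l) N"
  have "indep_var (?P {j}) (?A {j}) (?P (J - {j})) (?A (J - {j}))"
    using \<open>j \<in> J\<close> by (intro indep_var_restrict[OF indep]) auto
  moreover have "(\<lambda>x. x j) \<in> measurable (?P {j}) (PiM (C j) N)"
    by measurable
  moreover have "(\<lambda>x. \<lambda>i\<in>w. x (b i) i) \<in> measurable (?P (J - {j})) (PiM w N)"
  proof (rule measurable_restrict)
    fix i assume "i \<in> w"
    then have "(\<lambda>x. x (b i)) \<in> measurable (?P (J - {j})) (PiM (C (b i)) N)"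
      and "(\<lambda>x. x i) \<in> measurable (PiM (C (b i)) N) (N i)"
      using b by (auto intro: measurable_component_singleton)
    then show "(\<lambda>x. x (b i) i) \<in> measurable (?P (J - {j})) (N i)"
      by (rule measurable_compose)
  qed
  ultimately have "indep_var (PiM (C j) N) ((\<lambda>x. x j) \<circ> ?A {j})
      (PiM w N) ((\<lambda>x. \<lambda>i\<in>w. x (b i) i) \<circ> ?A (J - {j}))"
    by (rule indep_var_compose)
  moreover have "(\<lambda>x. x j) \<circ> ?A {j} = subvector X (C j)"
    by auto
  moreover have "(\<lambda>x. \<lambda>i\<in>w. x (b i) i) \<circ> ?A (J - {j}) = subvector X w"
    using b by (auto simp: subvector_def fun_eq_iff restrict_def)
  ultimately have "indep_var (PiM (C j) N) (subvector X (C j)) (PiM w N) (subvector X w)"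
    by simp
  then show ?thesis
    by (simp add: indep_var_eq sigma_subvector_def sets_vimage_algebra)
qed

section \<open>Block-additive models\<close>

text \<open>
  Almost surely \<open>E (Y | X\<^sub>v) = (\<Sum>j. E (g\<^sub>j (A\<^sub>j) | X\<^sub>v)) = (\<Sum>j. E (g\<^sub>j (A\<^sub>j) | X\<^bsub>v \<inter> C\<^sub>j\<^esub>))\<close>: given the
  coordinates in \<open>C\<^sub>j\<close>, the other coordinates carry no information on \<open>A\<^sub>j\<close>. The last sum has
  pairwise independent terms, each a function of its own block.
\<close>

lemma (in prob_space) closed_sobol_var_block_additive:
  fixes g :: "nat \<Rightarrow> (nat \<Rightarrow> 'b) \<Rightarrow> real"
  assumes X: "X \<in> measurable M (PiM I N)" and "finite J" and C: "(\<Union>j\<in>J. C j) = I"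
    and indep: "indep_vars (\<lambda>j. PiM (C j) N) (\<lambda>j. subvector X (C j)) J"
    and g: "\<And>j. j \<in> J \<Longrightarrow> g j \<in> borel_measurable (PiM (C j) N)"
    and sq: "\<And>j. j \<in> J \<Longrightarrow> integrable M (\<lambda>\<omega>. (g j (subvector X (C j) \<omega>))\<^sup>2)"
    and Y: "Y \<in> borel_measurable M" "AE \<omega> in M. Y \<omega> = (\<Sum>j\<in>J. g j (subvector X (C j) \<omega>))"
    and "v \<subseteq> I"
  shows "closed_sobol_var M N X Y v =
    (\<Sum>j\<in>J. closed_sobol_var M N X (\<lambda>\<omega>. g j (subvector X (C j) \<omega>)) (v \<inter> C j))"
proof -
  let ?F = "sigma_subvector M N X"
  \<comment> \<open>Extended by \<open>0\<close> outside \<open>J\<close> to make \<open>Z j\<close> integrable for every \<open>j\<close>, as \<open>real_cond_exp_sum\<close>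
    requires.\<close>
  define Z where "Z j \<omega> = (if j \<in> J then g j (subvector X (C j) \<omega>) else 0)" for j \<omega>
  define h where "h j = real_cond_exp M (?F (v \<inter> C j)) (Z j)" for j
  have CI: "C j \<subseteq> I" if "j \<in> J" for j
    using C that by auto
  have ZC: "Z j \<in> borel_measurable (?F (C j))" if "j \<in> J" for j
    using that measurable_compose[OF subvector_measurable_sigma_subvector[OF X CI] g]
    by (simp add: Z_def[abs_def])
  have ZM: "Z j \<in> borel_measurable M" if "j \<in> J" for j
    using measurable_from_subalg[OF subalgebra_sigma_subvector[OF X CI] ZC] that by simp
  have Zsq: "integrable M (\<lambda>\<omega>. (Z j \<omega>)\<^sup>2)" for j
    using sq by (cases "j \<in> J") (simp_all add: Z_def)
  have Z: "integrable M (Z j)" for j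
  proof (cases "j \<in> J")
    case True
    then show ?thesis
      using square_integrable_imp_integrable[OF ZM Zsq] by blast
  qed (simp add: Z_def[abs_def])
  have Fv: "subalgebra M (?F v)"
    by (rule subalgebra_sigma_subvector[OF X \<open>v \<subseteq> I\<close>])
  interpret Fv: sigma_finite_subalgebra M "?F v"
    by (rule sigma_finite_subalgebraI) fact
  have Fj: "subalgebra M (?F (v \<inter> C j))" for j
    using \<open>v \<subseteq> I\<close> by (intro subalgebra_sigma_subvector[OF X]) auto
  have drop: "AE \<omega> in M. real_cond_exp M (?F v) (Z j) \<omega> = h j \<omega>" if j: "j \<in> J" for j
    unfolding h_def
  proof (rule real_cond_exp_join_indep)
    show "subalgebra M (?F (C j))" "subalgebra (?F (C j)) (?F (v \<inter> C j))"
      "subalgebra M (?F (v - C j))"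
      using \<open>v \<subseteq> I\<close> CI[OF j]
      by (blast intro: subalgebra_sigma_subvector[OF X] subalgebra_sigma_subvector_mono[OF X])+
    show "indep_set (sets (?F (C j))) (sets (?F (v - C j)))"
      using \<open>v \<subseteq> I\<close> C by (intro indep_set_sigma_subvector[OF indep j]) auto
    have "v = (v \<inter> C j) \<union> (v - C j)"
      by auto
    then show "sets (?F v) = sigma_sets (space M)
        {a \<inter> b |a b. a \<in> sets (?F (v \<inter> C j)) \<and> b \<in> sets (?F (v - C j))}"
      using sets_sigma_subvector_Un[OF X, of "v \<inter> C j" "v - C j"] \<open>v \<subseteq> I\<close> by auto
  qed (use Fv ZC[OF j] Z in auto)
  have "AE \<omega> in M. real_cond_exp M (?F v) Y \<omega> = real_cond_exp M (?F v) (\<lambda>\<omega>. \<Sum>j\<in>J. Z j \<omega>) \<omega>"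
  proof (rule Fv.real_cond_exp_cong)
    show "AE \<omega> in M. Y \<omega> = (\<Sum>j\<in>J. Z j \<omega>)"
      using Y(2) by (simp add: Z_def)
    show "(\<lambda>\<omega>. \<Sum>j\<in>J. Z j \<omega>) \<in> borel_measurable M"
      using ZM by (rule borel_measurable_sum)
  qed (rule Y(1))
  moreover have "AE \<omega> in M. real_cond_exp M (?F v) (\<lambda>\<omega>. \<Sum>j\<in>J. Z j \<omega>) \<omega> =
      (\<Sum>j\<in>J. real_cond_exp M (?F v) (Z j) \<omega>)"
    by (rule Fv.real_cond_exp_sum[OF Z])
  moreover have "AE \<omega> in M. \<forall>j\<in>J. real_cond_exp M (?F v) (Z j) \<omega> = h j \<omega>"
    using drop \<open>finite J\<close> by (intro AE_finite_allI) auto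
  ultimately have "AE \<omega> in M. real_cond_exp M (?F v) Y \<omega> = (\<Sum>j\<in>J. h j \<omega>)"
    by eventually_elim simp
  then have "variance (real_cond_exp M (?F v) Y) = variance (\<lambda>\<omega>. \<Sum>j\<in>J. h j \<omega>)"
    by (rule variance_cong_AE) (auto simp: h_def)
  also have "\<dots> = (\<Sum>j\<in>J. variance (h j))"
  proof (rule variance_sum_indep[OF \<open>finite J\<close>])
    fix j
    interpret sigma_finite_subalgebra M "?F (v \<inter> C j)"
      by (rule sigma_finite_subalgebraI) fact
    show "integrable M (h j)"
      unfolding h_def by (rule real_cond_exp_int(1)[OF Z])
    show "integrable M (\<lambda>\<omega>. (h j \<omega>)\<^sup>2)"
      unfolding h_def by (rule integrable_real_cond_exp_power2[OF Fj Z Zsq])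
  next
    fix j l assume jl: "j \<in> J" "l \<in> J" "j \<noteq> l"
    have hC: "h i \<in> borel_measurable (?F (C i))" if "i \<in> J" for i
      unfolding h_def
      by (rule measurable_from_subalg[OF
            subalgebra_sigma_subvector_mono[OF X CI[OF that] Int_lower2] borel_measurable_cond_exp])
    show "indep_var borel (h j) borel (h l)"
      using jl by (intro indep_var_from_indep_subalgebras[OF subalgebra_sigma_subvector[OF X CI]
            subalgebra_sigma_subvector[OF X CI] indep_set_sigma_subvector[OF indep] hC hC]) auto
  qed
  finally show ?thesis
    by (simp add: closed_sobol_var_def cond_exp_subvector_def sigma_subvector_def[symmetric]
        h_def Z_def[abs_def] cong: sum.cong)
qed

theorem corollary1:
  fixes M :: "'w measure"
    and p k :: nat
    and N :: "nat \<Rightarrow> 'a measure"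
    and X :: "'w \<Rightarrow> nat \<Rightarrow> 'a"
    and f :: "(nat \<Rightarrow> 'a) \<Rightarrow> real"
    and C :: "nat \<Rightarrow> nat set"
    and g :: "nat \<Rightarrow> (nat \<Rightarrow> 'a) \<Rightarrow> real"
  assumes "prob_space M"
    and "X \<in> measurable M (PiM {1..p} N)"
    and "f \<in> borel_measurable (PiM {1..p} N)"
    and "integrable M (\<lambda>\<omega>. (f (X \<omega>))\<^sup>2)"
    and "prob_space.variance M (\<lambda>\<omega>. f (X \<omega>)) \<noteq> 0"
    and "\<forall>j\<in>{1..k}. C j \<noteq> {}"
    and "disjoint_family_on C {1..k}"
    and "(\<Union>j\<in>{1..k}. C j) = {1..p}"
    and "prob_space.indep_vars M (\<lambda>j. PiM (C j) N) (\<lambda>j. subvector X (C j)) {1..k}"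
    and "\<forall>j\<in>{1..k}. g j \<in> borel_measurable (PiM (C j) N)"
    and "\<forall>j\<in>{1..k}. integrable M (\<lambda>\<omega>. (g j (subvector X (C j) \<omega>))\<^sup>2)"
    and "AE \<omega> in M. f (X \<omega>) = (\<Sum>j\<in>{1..k}. g j (subvector X (C j) \<omega>))"
  shows "\<forall>u\<subseteq>{1..p}. (\<forall>j\<in>{1..k}. \<not> u \<subseteq> C j) \<longrightarrow> sobol_index M N X (\<lambda>\<omega>. f (X \<omega>)) u = 0"
proof (intro allI impI)
  fix u assume u: "u \<subseteq> {1..p}" and nu: "\<forall>j\<in>{1..k}. \<not> u \<subseteq> C j"
  interpret prob_space M by fact
  define c where "c j = closed_sobol_var M N X (\<lambda>\<omega>. g j (subvector X (C j) \<omega>))" for j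
  have "finite u"
    using u finite_subset by blast
  have "(\<Sum>v\<in>Pow u. (- 1) ^ (card u - card v) * closed_sobol_var M N X (\<lambda>\<omega>. f (X \<omega>)) v) =
      (\<Sum>v\<in>Pow u. (- 1) ^ (card u - card v) * (\<Sum>j\<in>{1..k}. c j (v \<inter> C j)))"
    using u assms(8-12) measurable_compose[OF assms(2,3)] unfolding c_def
    by (intro sum.cong refl arg_cong2[where f = "(*)"]
        closed_sobol_var_block_additive[OF assms(2)]) auto
  also have "\<dots> = (\<Sum>j\<in>{1..k}. \<Sum>v\<in>Pow u. (- 1) ^ (card u - card v) * c j (v \<inter> C j))"
    by (simp only: sum_distrib_left) (rule sum.swap)
  also have "\<dots> = 0"
  proof (rule sum.neutral, rule ballI)
    fix j assume "j \<in> {1..k}"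
    with nu obtain i where "i \<in> u" "i \<notin> C j"
      by blast
    then show "(\<Sum>v\<in>Pow u. (- 1) ^ (card u - card v) * c j (v \<inter> C j)) = 0"
      using \<open>finite u\<close> by (intro alternating_sum_Pow_eq_0[of u i]) auto
  qed
  finally show "sobol_index M N X (\<lambda>\<omega>. f (X \<omega>)) u = 0"
    by (simp add: sobol_index_def)
qed

end
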